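(* Let $G$ be a finite simple graph with vertex set $V(G)$. For each vertex $v$ let $d_v$ denote the degree of $v$ in $G$. Let $\lambda > 0$ be real. Then \[ P_G(\lambda) \ge \prod_{v \in V(G)} P_{K_{d_v+1}}(\lambda)^{1/(d_v+1)} = \prod_{v \in V(G)} \left((d_v+1)\lambda + 1\right)^{1/(d_v+1)}. \] Equality in the inequality holds if and only if $G$ is a disjoint union of cliques.
   Context: All graphs are finite and simple (undirected). For a graph $G$, $\mathcal{I}(G)$ denotes the set of independent sets of $G$ (including the empty set), and the independent set polynomial is $P_G(\lambda) = \sum_{I \in \mathcal{I}(G)} \lambda^{|I|}$. $K_m$ denotes the complete graph on $m$ vertices. A clique here means a complete graph $K_m$ with $m \ge 1$ (so an isolated vertex is a clique $K_1$). In a disjoint union of cliques, the components may have different sizes. *)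

theory Defs
  imports Complex_Main "Graph_Theory.Kuratowski"
begin

text \<open>
  Finite simple graphs are the locale \<^locale>\<open>graph\<close> of Graph Theory: finite, loop-free
  symmetric digraphs without parallel arcs. An undirected edge is a pair of opposite arcs, so the
  degree of a vertex is its \<^const>\<open>out_degree\<close>.
\<close>

definition independent_sets :: "('a, 'b) pre_digraph \<Rightarrow> 'a set set" where
  "independent_sets G = {I. I \<subseteq> verts G \<and> (\<forall>u\<in>I. \<forall>v\<in>I. \<not> u \<rightarrow>\<^bsub>G\<^esub> v)}"

definition indep_poly :: "('a, 'b) pre_digraph \<Rightarrow> real \<Rightarrow> real" where
  "indep_poly G x = (\<Sum>I\<in>independent_sets G. x ^ card I)"

definition complete_graph :: "nat \<Rightarrow> (nat, nat \<times> nat) pre_digraph" where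
  "complete_graph m =
     with_proj \<lparr> pverts = {..<m}, parcs = {(u, v). u < m \<and> v < m \<and> u \<noteq> v} \<rparr>"

lemma complete_digraph_complete_graph: "complete_digraph m (complete_graph m)"
  unfolding complete_graph_def complete_digraph_pair_def by auto

text \<open>
  \<^const>\<open>pre_digraph.Union\<close> takes the incidence maps of the result from its first argument and ignores
  those of the members of the family, hence the requirement that the members be
  \<^const>\<open>compatible\<close> with \<open>G\<close>. The empty family yields the null graph.
\<close>

definition disjoint_union_of_cliques :: "('a, 'b) pre_digraph \<Rightarrow> bool" where
  "disjoint_union_of_cliques G \<longleftrightarrow>
     (\<exists>\<C>. (\<forall>C\<in>\<C>. compatible G C \<and> (\<exists>m\<ge>1. complete_digraph m C)) \<and>
          (\<forall>C\<in>\<C>. \<forall>D\<in>\<C>. C \<noteq> D \<longrightarrow> verts C \<inter> verts D = {}) \<and>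
          G = pre_digraph.Union G \<C>)"

end

theory Submission
  imports Defs
begin

text \<open>
  Write \<open>w d = ((d + 1) x + 1) powr (1 / (d + 1))\<close>. The proof is an induction on the number of
  vertices that deletes a vertex \<open>v\<close> of maximum degree \<open>\<Delta>\<close>. Let \<open>N\<close> be its neighbourhood and \<open>W\<close>
  the set of the remaining vertices. Splitting the independent sets by whether they contain \<open>v\<close>
  gives \<open>P(V) = P(N \<union> W) + x P(W)\<close>. In \<open>N \<union> W\<close> each \<open>u \<in> N\<close> has lost one neighbour, and in
  both sets no degree has grown. Since \<open>w\<close> is decreasing, the induction hypothesis bounds \<open>P(V)\<close>
  below by \<open>Q (\<Prod>u\<in>N. w (d u - 1)) + x Q\<close>, where \<open>Q\<close> is the product of \<open>w (d u)\<close> over \<open>W\<close>. What is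
  left to show is a statement about \<open>\<Delta>\<close> numbers \<open>d u \<le> \<Delta>\<close>, \<open>neighbourhood_inequality\<close>:
  \<open>(\<Prod>u\<in>N. w (d u - 1)) + x \<ge> w \<Delta> (\<Prod>u\<in>N. w (d u))\<close>.

  If all \<open>d u\<close> equal \<open>\<Delta>\<close>, this is the identity \<open>\<Delta> x + 1 + x = (\<Delta> + 1) x + 1\<close>. Otherwise raise the
  \<open>d u\<close> to \<open>\<Delta>\<close> one unit at a time; each such step strictly decreases the ratio of the left side to
  the right side. Because \<open>w d ^ d\<close> increases with \<open>d\<close>, the critical instance of such a step is the
  one in which \<open>\<Delta> = d u + 1\<close> and all other degrees equal \<open>\<Delta>\<close>, and this is an inequality in two
  parameters (\<open>clique_root_exchange\<close>). In logarithmic form it follows from the convexity of an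
  explicit function of one variable (\<open>deleted_clique_log_inequality\<close>).

  Equality throughout requires that all neighbours of \<open>v\<close> have degree \<open>\<Delta>\<close> and that no vertex of \<open>W\<close>
  has a neighbour in \<open>N\<close>. So equality forces \<open>{v} \<union> N\<close> to be a clique without edges to the rest, and
  passes on to \<open>W\<close>. Conversely, \<open>P\<close> is multiplicative over disjoint unions and
  \<open>P = w d ^ (d + 1)\<close> for a clique on \<open>d + 1\<close> vertices.
\<close>

section \<open>The one-variable inequality\<close>

text \<open>
  With \<open>a = n x + 1\<close> and \<open>e = x / a\<close> one has \<open>1 - n e = 1 / a\<close> and \<open>a (1 \<plusminus> e) = a \<plusminus> x\<close>, so the
  logarithms below are combinations of those of the independence polynomials of the cliques on
  \<open>n - 1\<close>, \<open>n\<close> and \<open>n + 1\<close> vertices. The difference of the two sides vanishes at \<open>e = 0\<close> together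
  with its first derivative, and its second derivative is positive for \<open>e > 0\<close>.
\<close>

lemma deleted_clique_log_inequality:
  fixes n e :: real
  assumes n: "n > 1" and e: "0 < e" "n * e < 1"
  shows "(n - 1) * (1 + e) * (- ln (1 - n * e) / n - ln (1 + e))
       < (n + 1) * (- ln (1 - n * e) / n + ln (1 - e))"
proof -
  define g where "g t = (n + 1) * (- ln (1 - n * t) / n + ln (1 - t))
      - (n - 1) * (1 + t) * (- ln (1 - n * t) / n - ln (1 + t))" for t
  define g' where "g' t = (n + 1) * (1 / (1 - n * t) - 1 / (1 - t))
      - (n - 1) * (- ln (1 - n * t) / n - ln (1 + t))
      - (n - 1) * ((n + 1) * (t / (1 - n * t)))" for t
  have dom: "1 - n * t > 0" "1 - t > 0" "1 + t > 0" if "0 \<le> t" "t \<le> e" for t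
  proof -
    have "n * t \<le> n * e" using that n by (intro mult_left_mono) auto
    then show a: "1 - n * t > 0" using e by simp
    have "t \<le> n * t" using that n by (simp add: mult_le_cancel_right1)
    then show "1 - t > 0" using a by simp
    show "1 + t > 0" using that by simp
  qed
  have dL: "((\<lambda>t. - ln (1 - n * t) / n) has_real_derivative 1 / (1 - n * t)) (at t)"
    if "0 \<le> t" "t \<le> e" for t
    using dom[OF that] n by (auto intro!: derivative_eq_intros)
  have dM: "((\<lambda>t. ln (1 + t)) has_real_derivative 1 / (1 + t)) (at t)"
    and dN: "((\<lambda>t. ln (1 - t)) has_real_derivative - (1 / (1 - t))) (at t)"
    if "0 \<le> t" "t \<le> e" for t
    using dom[OF that] by (auto intro!: derivative_eq_intros)
  have dg: "(g has_real_derivative g' t) (at t)" if "0 \<le> t" "t \<le> e" for t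
  proof -
    note d = dom[OF that]
    have "(g has_real_derivative (n + 1) * (1 / (1 - n * t) + - (1 / (1 - t)))
        - ((n - 1) * (- ln (1 - n * t) / n - ln (1 + t))
           + (1 / (1 - n * t) - 1 / (1 + t)) * ((n - 1) * (1 + t)))) (at t)"
      unfolding g_def
      by (intro DERIV_diff DERIV_mult DERIV_cmult DERIV_add dL[OF that] dM[OF that] dN[OF that])
        (auto intro!: derivative_eq_intros)
    moreover have "(1 / (1 - n * t) - 1 / (1 + t)) * ((n - 1) * (1 + t))
        = (n - 1) * ((n + 1) * (t / (1 - n * t)))"
    proof -
      have "1 / (1 - n * t) - 1 / (1 + t) = (n + 1) * (t / (1 - n * t)) / (1 + t)"
        using d by (simp add: divide_simps) (simp add: algebra_simps)
      then show ?thesis using d by simp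
    qed
    ultimately show ?thesis unfolding g'_def by (simp add: diff_diff_eq)
  qed
  have dg': "(g' has_real_derivative
       (n + 1) * (n / (1 - n * t)\<^sup>2 - 1 / (1 - t)\<^sup>2) - (n - 1) * (1 / (1 - n * t) - 1 / (1 + t))
       - (n - 1) * ((n + 1) * (1 / (1 - n * t)\<^sup>2))) (at t)" if "0 \<le> t" "t \<le> e" for t
  proof -
    note d = dom[OF that]
    have "((\<lambda>t. 1 / (1 - n * t)) has_real_derivative n / (1 - n * t)\<^sup>2) (at t)"
      "((\<lambda>t. 1 / (1 - t)) has_real_derivative 1 / (1 - t)\<^sup>2) (at t)"
      "((\<lambda>t. t / (1 - n * t)) has_real_derivative 1 / (1 - n * t)\<^sup>2) (at t)"
      using d by (auto intro!: derivative_eq_intros simp: power2_eq_square)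
    then show ?thesis
      unfolding g'_def by (intro DERIV_diff DERIV_cmult dL[OF that] dM[OF that])
  qed
  have pos: "(n + 1) * (n / (1 - n * t)\<^sup>2 - 1 / (1 - t)\<^sup>2) - (n - 1) * (1 / (1 - n * t) - 1 / (1 + t))
       - (n - 1) * ((n + 1) * (1 / (1 - n * t)\<^sup>2)) > 0" if t: "0 < t" "t \<le> e" for t
  proof -
    define p q r where "p = 1 / (1 - n * t)" and "q = 1 / (1 - t)" and "r = 1 / (1 + t)"
    have d: "1 - n * t > 0" "1 - t > 0" "1 + t > 0" using dom t by auto
    have "n * t > 0" using t n by simp
    then have p1: "p \<ge> 1" unfolding p_def using d by simp
    have q1: "q \<ge> 1" unfolding q_def using d t by simp
    have r1: "r \<le> 1" unfolding r_def using d t by simp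
    have pq: "p - q = (n - 1) * t * p * q"
      unfolding p_def q_def using d by (simp add: field_simps)
    have pr: "p - r = (n + 1) * t * p * r"
      unfolding p_def r_def using d by (simp add: field_simps)
    have "(n + 1) * (n / (1 - n * t)\<^sup>2 - 1 / (1 - t)\<^sup>2) - (n - 1) * (1 / (1 - n * t) - 1 / (1 + t))
       - (n - 1) * ((n + 1) * (1 / (1 - n * t)\<^sup>2))
      = (n + 1) * (n * p\<^sup>2 - q\<^sup>2) - (n - 1) * (p - r) - (n - 1) * ((n + 1) * p\<^sup>2)"
      by (simp add: p_def q_def r_def power_divide)
    also have "\<dots> = (n + 1) * ((p - q) * (p + q)) - (n - 1) * (p - r)"
      by (simp add: algebra_simps power2_eq_square)
    \<comment> \<open>Both differences contain the factor \<open>t * p\<close>.\<close>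
    also have "\<dots> = (n + 1) * (n - 1) * t * p * (q * (p + q) - r)"
      unfolding pq pr by (simp add: algebra_simps)
    also have "\<dots> > 0"
    proof -
      have "1 * 2 \<le> q * (p + q)" using p1 q1 by (intro mult_mono) auto
      then show ?thesis using r1 p1 t n by simp
    qed
    finally show ?thesis .
  qed
  have g'pos: "g' t > 0" if t: "0 < t" "t \<le> e" for t
  proof -
    have "g' 0 < g' t"
    proof (rule DERIV_pos_imp_increasing_open[OF t(1)])
      show "\<exists>y. DERIV g' u :> y \<and> y > 0" if "0 < u" "u < t" for u
        using dg'[of u] pos[of u] that t by fastforce
      show "continuous_on {0..t} g'"
        using dg' t by (intro DERIV_atLeastAtMost_imp_continuous_on) fastforce
    qed
    then show ?thesis by (simp add: g'_def)
  qed
  have "g 0 < g e"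
  proof (rule DERIV_pos_imp_increasing_open[OF e(1)])
    show "\<exists>y. DERIV g u :> y \<and> y > 0" if "0 < u" "u < e" for u
      using dg[of u] g'pos[of u] that by fastforce
    show "continuous_on {0..e} g"
      using dg by (intro DERIV_atLeastAtMost_imp_continuous_on) fastforce
  qed
  then show ?thesis by (simp add: g_def)
qed

section \<open>Roots of clique polynomials\<close>

definition clique_root :: "real \<Rightarrow> nat \<Rightarrow> real" where
  "clique_root x d = ((real d + 1) * x + 1) powr (1 / (real d + 1))"

context
  fixes x :: real
  assumes x: "x > 0"
begin

lemma clique_poly_gt_1: "(real d + 1) * x + 1 > 1"
  using x by simp

lemma clique_root_gt_1: "clique_root x d > 1"
  unfolding clique_root_def using clique_poly_gt_1[of d] by (intro gr_one_powr) auto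

lemma clique_root_pos: "clique_root x d > 0"
  using clique_root_gt_1[of d] by simp

lemma clique_root_pow: "clique_root x d ^ Suc d = (real d + 1) * x + 1"
proof -
  have "clique_root x d ^ Suc d = clique_root x d powr (real d + 1)"
    using clique_root_pos[of d] by (simp add: powr_realpow[symmetric] add.commute del: power_Suc)
  also have "\<dots> = (real d + 1) * x + 1"
    unfolding clique_root_def powr_powr using clique_poly_gt_1[of d] by simp
  finally show ?thesis .
qed

lemma ln_clique_root: "ln (clique_root x d) = ln ((real d + 1) * x + 1) / (real d + 1)"
  unfolding clique_root_def using clique_poly_gt_1[of d] by (simp add: ln_powr)

text \<open>
  After taking logarithms this is \<open>(d + 1) ln (1 + x / a) < ln a\<close> with \<open>a = (d + 1) x + 1\<close>, and
  \<open>(d + 1) x / a = 1 - 1 / a\<close> separates the two sides.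
\<close>

lemma clique_root_Suc_less: "clique_root x (Suc d) < clique_root x d"
proof -
  define a where "a = (real d + 1) * x + 1"
  have a: "a > 1" unfolding a_def by (rule clique_poly_gt_1)
  have "ln (1 / a) \<le> 1 / a - 1" using a by (intro ln_le_minus_one) simp
  then have 1: "1 - 1 / a \<le> ln a" using a by (simp add: ln_div)
  have "ln (1 + x / a) < x / a"
  proof -
    have p: "x / a > 0" using x a by simp
    then show ?thesis
      using ln_le_minus_one[of "1 + x / a"] ln_eq_minus_one[of "1 + x / a"] by linarith
  qed
  have "(real d + 1) * ln (1 + x / a) < (real d + 1) * (x / a)"
    using \<open>ln (1 + x / a) < x / a\<close> by (intro mult_strict_left_mono) auto
  also have "\<dots> = 1 - 1 / a" using a unfolding a_def by (simp add: field_simps)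
  also note 1
  finally have "(real d + 1) * ln (1 + x / a) < ln a" .
  moreover have "ln (a + x) = ln a + ln (1 + x / a)"
    using a x by (subst ln_mult_pos[symmetric]) (auto simp: field_simps add_pos_pos)
  ultimately have "(real d + 1) * ln (a + x) < (real d + 2) * ln a"
    by (simp add: algebra_simps)
  then have "ln (a + x) / (real d + 2) < ln a / (real d + 1)"
    by (simp add: field_simps)
  then have "ln (clique_root x (Suc d)) < ln (clique_root x d)"
    unfolding ln_clique_root by (simp add: a_def algebra_simps)
  then show ?thesis using clique_root_pos by simp
qed

lemma clique_root_strict_antimono: "d < d' \<Longrightarrow> clique_root x d' < clique_root x d"
  using lift_Suc_mono_less[of "\<lambda>d. - clique_root x d" d d'] clique_root_Suc_less by simp

lemma clique_root_antimono: "d \<le> d' \<Longrightarrow> clique_root x d' \<le> clique_root x d"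
  using clique_root_strict_antimono[of d d'] by (cases "d = d'") auto

text \<open>
  The neighbourhood inequality for a vertex of degree \<open>k + 2\<close> with one neighbour of degree \<open>k + 1\<close>
  and \<open>k + 1\<close> neighbours of degree \<open>k + 2\<close>. For \<open>X\<close> and \<open>Y\<close> the successive differences of
  \<open>ln (clique_root x d)\<close> and \<open>e = x / a\<close>, dividing by \<open>a = clique_root x (k + 1) ^ (k + 2)\<close> turns
  it into \<open>exp Y * (1 + e) < exp X + e\<close>. By \<open>exp Y - 1 \<le> Y exp Y\<close> and
  \<open>exp (X - Y) - 1 \<ge> X - Y\<close> it is enough that \<open>e Y < X - Y\<close>, which is the logarithmic inequality
  above.
\<close>

lemma clique_root_exchange:
  "clique_root x (Suc k) * clique_root x (Suc (Suc k)) ^ Suc (Suc k)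
     < clique_root x (Suc k) ^ Suc k * clique_root x k + x"
proof -
  define n where "n = real k + 2"
  define a where "a = n * x + 1"
  define e where "e = x / a"
  define \<alpha> \<beta> \<gamma> where "\<alpha> = ln (clique_root x (Suc k))"
    and "\<beta> = ln (clique_root x k)" and "\<gamma> = ln (clique_root x (Suc (Suc k)))"
  define X Y where "X = \<beta> - \<alpha>" and "Y = \<alpha> - \<gamma>"
  have n: "n > 1" by (simp add: n_def)
  have a: "a > 1" unfolding a_def using n x by simp
  have e: "0 < e" "n * e < 1" unfolding e_def using a x by (auto simp: a_def field_simps)
  have e1: "1 - n * e = 1 / a" "1 - e = (a - x) / a" "1 + e = (a + x) / a"
    unfolding e_def using a by (auto simp: a_def field_simps)
  have ax: "a - x > 1" unfolding a_def n_def using x by (simp add: algebra_simps add_pos_nonneg)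
  have \<alpha>: "\<alpha> = ln a / n"
    unfolding \<alpha>_def ln_clique_root a_def n_def by (simp add: algebra_simps)
  have \<beta>: "\<beta> = ln (a - x) / (n - 1)"
    unfolding \<beta>_def ln_clique_root a_def n_def by (simp add: algebra_simps)
  have \<gamma>: "\<gamma> = ln (a + x) / (n + 1)"
    unfolding \<gamma>_def ln_clique_root a_def n_def by (simp add: algebra_simps)
  have "ln (1 - e) = ln (a - x) - ln a" "ln (1 + e) = ln (a + x) - ln a" "ln (1 - n * e) = - ln a"
    unfolding e1 using ax a x by (auto simp: ln_div)
  moreover from this have X: "(n - 1) * X = - ln (1 - n * e) / n + ln (1 - e)"
    and Y: "(n + 1) * Y = - ln (1 - n * e) / n - ln (1 + e)"
  proof -
    assume l: "ln (1 - e) = ln (a - x) - ln a" "ln (1 + e) = ln (a + x) - ln a"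
      "ln (1 - n * e) = - ln a"
    have "(n - 1) * \<beta> = ln (a - x)" "(n + 1) * \<gamma> = ln (a + x)" "n * \<alpha> = ln a"
      unfolding \<alpha> \<beta> \<gamma> using n by auto
    moreover have "- ln (1 - n * e) / n = \<alpha>" unfolding l \<alpha> by simp
    ultimately show "(n - 1) * X = - ln (1 - n * e) / n + ln (1 - e)"
      "(n + 1) * Y = - ln (1 - n * e) / n - ln (1 + e)"
      using l by (simp_all add: X_def Y_def algebra_simps)
  qed
  ultimately have "(n - 1) * (1 + e) * ((n + 1) * Y) < (n + 1) * ((n - 1) * X)"
    using deleted_clique_log_inequality[OF n e] by simp
  then have "((n + 1) * (n - 1)) * ((1 + e) * Y) < ((n + 1) * (n - 1)) * X"
    by (simp add: mult_ac)
  moreover have "(n + 1) * (n - 1) > 0" using n by simp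
  ultimately have "(1 + e) * Y < X" by (simp only: mult_less_cancel_left_pos)
  then have XY: "e * Y < X - Y" by (simp add: algebra_simps)
  have "exp Y * (1 - Y) \<le> exp Y * exp (- Y)"
    using exp_ge_add_one_self[of "- Y"] by (intro mult_left_mono) auto
  then have "exp Y - 1 \<le> exp Y * Y" by (simp add: exp_minus algebra_simps)
  then have "e * (exp Y - 1) \<le> e * (exp Y * Y)" using e by (intro mult_left_mono) auto
  also have "\<dots> = exp Y * (e * Y)" by simp
  also have "\<dots> < exp Y * (X - Y)" using XY by simp
  also have "\<dots> \<le> exp Y * (exp (X - Y) - 1)"
    using exp_ge_add_one_self[of "X - Y"] by (intro mult_left_mono) (linarith, simp)
  also have "\<dots> = exp X - exp Y" by (simp add: algebra_simps flip: exp_add)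
  finally have main: "exp Y * (1 + e) < exp X + e" by (simp add: algebra_simps)
  define u v w where "u = clique_root x k" and "v = clique_root x (Suc k)"
    and "w = clique_root x (Suc (Suc k))"
  have pos: "u > 0" "v > 0" "w > 0" by (simp_all add: u_def v_def w_def clique_root_pos)
  have eX: "exp X = u / v" and eY: "exp Y = v / w"
    unfolding X_def Y_def \<alpha>_def \<beta>_def \<gamma>_def u_def v_def w_def
    using clique_root_pos by (simp_all add: exp_diff)
  have va: "v ^ Suc (Suc k) = a"
    unfolding v_def clique_root_pow a_def n_def by (simp add: algebra_simps)
  have wa: "w ^ Suc (Suc (Suc k)) = a + x"
    unfolding w_def clique_root_pow a_def n_def by (simp add: algebra_simps)
  have "v * w ^ Suc (Suc k) = a * (exp Y * (1 + e))"
    unfolding eY e1 using wa pos a by (simp add: field_simps)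
  also have "\<dots> < a * (exp X + e)" using main a by simp
  also have "\<dots> = v ^ Suc k * u + x"
  proof -
    have "a * (u / v) = v ^ Suc k * u" using va[symmetric] pos by simp
    then show ?thesis unfolding eX e_def using a by (simp add: algebra_simps)
  qed
  finally show ?thesis unfolding u_def v_def w_def .
qed

text \<open>
  The power is \<open>((d + 1) x + 1) powr (d / (d + 1))\<close>, where both the base and the exponent increase
  with \<open>d\<close>.
\<close>

lemma clique_root_power_mono:
  assumes "k \<le> m"
  shows "clique_root x k ^ k \<le> clique_root x m ^ m"
proof -
  have ineq: "real k / (real k + 1) \<le> real m / (real m + 1)"
    using assms by (simp add: field_simps)
  have conv: "clique_root x d ^ d = ((real d + 1) * x + 1) powr (real d / (real d + 1))" for d
    using clique_root_pos[of d] clique_poly_gt_1[of d]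
    by (simp add: powr_realpow[symmetric] clique_root_def powr_powr)
  have "clique_root x k ^ k \<le> ((real k + 1) * x + 1) powr (real m / (real m + 1))"
    unfolding conv using ineq clique_poly_gt_1[of k] by (intro powr_mono) auto
  also have "\<dots> \<le> ((real m + 1) * x + 1) powr (real m / (real m + 1))"
    using assms x clique_poly_gt_1[of k] by (intro powr_mono2) auto
  finally show ?thesis unfolding conv .
qed

text \<open>
  Here \<open>S\<close> is the neighbourhood of a vertex of maximum degree \<open>n\<close>, and \<open>e i\<close> is one less than the
  degree of the neighbour \<open>i\<close>. The induction raises a single \<open>e i\<close> by one until all degrees are \<open>n\<close>,
  where equality holds because the clique polynomial is linear in the number of vertices.
\<close>

lemma neighbourhood_inequality:
  fixes e :: "'c \<Rightarrow> nat"
  assumes "finite S" and "card S = n" and "\<And>i. i \<in> S \<Longrightarrow> e i < n"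
  shows "clique_root x n * (\<Prod>i\<in>S. clique_root x (Suc (e i))) \<le> (\<Prod>i\<in>S. clique_root x (e i)) + x
    \<and> ((\<exists>i\<in>S. Suc (e i) < n) \<longrightarrow>
       clique_root x n * (\<Prod>i\<in>S. clique_root x (Suc (e i))) < (\<Prod>i\<in>S. clique_root x (e i)) + x)"
  using assms(3)
proof (induction "\<Sum>i\<in>S. n - e i" arbitrary: e rule: less_induct)
  case less
  let ?w = "clique_root x"
  show ?case
  proof (cases "\<exists>i\<in>S. Suc (e i) < n")
    case False
    then have e: "Suc (e i) = n" if "i \<in> S" for i using less.prems[OF that] that by force
    have "(\<Prod>i\<in>S. ?w (Suc (e i))) = (\<Prod>i\<in>S. ?w n)" using e by (intro prod.cong) auto
    moreover have "(\<Prod>i\<in>S. ?w (e i)) = (\<Prod>i\<in>S. ?w (n - 1))"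
      by (intro prod.cong) (use e in fastforce)+
    moreover have "?w n * ?w n ^ n = ?w (n - 1) ^ n + x"
    proof (cases n)
      case 0 then show ?thesis using clique_root_pow[of 0] by simp
    next
      case (Suc m)
      have "?w n * ?w n ^ n = ?w n ^ Suc n" by simp
      also have "\<dots> = (real n + 1) * x + 1" by (rule clique_root_pow)
      also have "\<dots> = ?w m ^ Suc m + x" unfolding clique_root_pow using Suc by (simp add: algebra_simps)
      finally show ?thesis using Suc by simp
    qed
    ultimately show ?thesis using False assms(2) by simp
  next
    case True
    then obtain i where i: "i \<in> S" "Suc (e i) < n" by blast
    define k where "k = e i"
    define e' where "e' = e(i := Suc k)"
    define A B where "A = (\<Prod>j\<in>S - {i}. ?w (e j))"
      and "B = ?w n * (\<Prod>j\<in>S - {i}. ?w (Suc (e j)))"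
    have P: "(\<Prod>j\<in>S. ?w (e j)) = ?w k * A"
      unfolding A_def k_def by (rule prod.remove[OF assms(1) i(1)])
    have P': "(\<Prod>j\<in>S. ?w (e' j)) = ?w (Suc k) * A"
      by (subst prod.remove[OF assms(1) i(1)]) (auto simp: A_def e'_def intro!: prod.cong)
    have Q: "?w n * (\<Prod>j\<in>S. ?w (Suc (e j))) = ?w (Suc k) * B"
      by (subst prod.remove[OF assms(1) i(1)]) (auto simp: B_def k_def)
    have Q': "?w n * (\<Prod>j\<in>S. ?w (Suc (e' j))) = ?w (Suc (Suc k)) * B"
      by (subst prod.remove[OF assms(1) i(1)]) (auto simp: B_def e'_def intro!: prod.cong)
    have "(\<Sum>j\<in>S. n - e' j) < (\<Sum>j\<in>S. n - e j)"
      using i assms(1)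
      by (intro sum_strict_mono_ex1) (auto simp: e'_def k_def intro!: bexI[of _ i])
    then have IH: "?w (Suc (Suc k)) * B \<le> ?w (Suc k) * A + x"
      using less.hyps[of e'] less.prems i P' Q' by (auto simp: e'_def k_def)
    define u v w where "u = ?w k" and "v = ?w (Suc k)" and "w = ?w (Suc (Suc k))"
    have pos: "u > 0" "v > 0" "w > 0" by (simp_all add: u_def v_def w_def clique_root_pos)
    \<comment> \<open>The product of the other factors is smallest when all other degrees are \<open>n\<close>, and among
      these cases when \<open>n = k + 2\<close>, which is the case treated in \<open>clique_root_exchange\<close>.\<close>
    have "v ^ Suc k \<le> ?w (n - 1) ^ (n - 1)"
      unfolding v_def using i by (intro clique_root_power_mono) (simp add: k_def)
    also have "\<dots> = (\<Prod>j\<in>S - {i}. ?w (n - 1))" using assms(1,2) i by simp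
    also have "\<dots> \<le> A" unfolding A_def using less.prems clique_root_pos
      by (intro prod_mono) (auto intro!: clique_root_antimono simp: less_imp_le Suc_le_eq dest!: less.prems)
    finally have A: "v ^ Suc k \<le> A" .
    have w: "w ^ Suc (Suc (Suc k)) = v ^ Suc (Suc k) + x"
      unfolding v_def w_def clique_root_pow by (simp add: algebra_simps)
    have "v * w ^ Suc (Suc k) * w < (v ^ Suc k * u + x) * w"
      using clique_root_exchange[of k] pos by (intro mult_strict_right_mono) (simp_all add: u_def v_def w_def)
    moreover have "v * w ^ Suc (Suc k) * w = v * (v ^ Suc (Suc k) + x)"
      unfolding w[symmetric] by simp
    ultimately have gap: "x * (v - w) < v ^ Suc k * (u * w - v * v)"
      by (simp add: algebra_simps)
    have "w < v" unfolding v_def w_def by (rule clique_root_Suc_less)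
    \<comment> \<open>Since \<open>w < v\<close>, \<open>gap\<close> also gives the log-convexity \<open>v * v < u * w\<close>, so that \<open>gap\<close>
      survives replacing the power of \<open>v\<close> by the larger \<open>A\<close>.\<close>
    then have "0 < v ^ Suc k * (u * w - v * v)" using gap x
      by (smt (verit) mult_pos_pos)
    then have "0 < u * w - v * v" using pos by (simp only: zero_less_mult_pos zero_less_power)
    then have "v ^ Suc k * (u * w - v * v) \<le> A * (u * w - v * v)"
      using A by (intro mult_right_mono) auto
    with gap have "v * (v * A + x) < w * (u * A + x)" by (simp add: algebra_simps)
    moreover have "v * (w * B) \<le> v * (v * A + x)"
      using IH pos unfolding v_def w_def by (intro mult_left_mono) auto
    ultimately have "w * (v * B) < w * (u * A + x)" by (simp add: algebra_simps)
    then have "v * B < u * A + x" using pos by simp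
    then show ?thesis unfolding P Q u_def v_def by simp
  qed
qed

end

section \<open>Independent sets of vertex subsets\<close>

text \<open>
  The induction passes to induced subgraphs, so adjacency is kept as one fixed relation and the
  vertex set varies.
\<close>

locale adjacency =
  fixes adj :: "'a \<Rightarrow> 'a \<Rightarrow> bool"
  assumes adj_sym: "adj u v \<Longrightarrow> adj v u"
    and adj_irrefl: "\<not> adj u u"
begin

definition indep :: "'a set \<Rightarrow> 'a set set" where
  "indep V = {I. I \<subseteq> V \<and> (\<forall>u\<in>I. \<forall>v\<in>I. \<not> adj u v)}"

definition ipoly :: "real \<Rightarrow> 'a set \<Rightarrow> real" where
  "ipoly x V = (\<Sum>I\<in>indep V. x ^ card I)"

definition nbrs :: "'a set \<Rightarrow> 'a \<Rightarrow> 'a set" where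
  "nbrs V u = {w \<in> V. adj u w}"

text \<open>
  Absence of an induced path on three vertices, which characterises the disjoint unions of cliques
  (\<open>disjoint_union_of_cliques_iff\<close> below).
\<close>

definition cluster :: "'a set \<Rightarrow> bool" where
  "cluster V \<longleftrightarrow> (\<forall>u\<in>V. \<forall>v\<in>V. \<forall>w\<in>V. adj u v \<longrightarrow> adj v w \<longrightarrow> u \<noteq> w \<longrightarrow> adj u w)"

lemma finite_indep: "finite V \<Longrightarrow> finite (indep V)"
  unfolding indep_def by (rule finite_subset[of _ "Pow V"]) auto

lemma finite_nbrs: "finite V \<Longrightarrow> finite (nbrs V u)"
  unfolding nbrs_def by auto

lemma ipoly_empty: "ipoly x {} = 1"
proof -
  have "indep {} = {{}}" unfolding indep_def by auto
  then show ?thesis unfolding ipoly_def by simp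
qed

text \<open>
  The independent sets containing \<open>v\<close> are the sets \<open>insert v I\<close> for the independent sets \<open>I\<close> of the
  vertices other than \<open>v\<close> and its neighbours.
\<close>

lemma ipoly_delete:
  assumes "finite V" "v \<in> V"
  shows "ipoly x V = ipoly x (V - {v}) + x * ipoly x (V - {v} - nbrs V v)"
proof -
  let ?W = "V - {v} - nbrs V v"
  have split: "indep V = indep (V - {v}) \<union> insert v ` indep ?W"
  proof (intro equalityI subsetI)
    fix I assume I: "I \<in> indep V"
    show "I \<in> indep (V - {v}) \<union> insert v ` indep ?W"
    proof (cases "v \<in> I")
      case True
      then have "I - {v} \<in> indep ?W" using I unfolding indep_def nbrs_def by blast
      moreover have "I = insert v (I - {v})" using True by blast
      ultimately show ?thesis by blast
    qed (use I in \<open>auto simp: indep_def\<close>)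
  next
    fix I assume "I \<in> indep (V - {v}) \<union> insert v ` indep ?W"
    then show "I \<in> indep V"
    proof
      assume "I \<in> insert v ` indep ?W"
      then obtain J where J: "I = insert v J" "J \<in> indep ?W" by blast
      then have "\<not> adj v u" "\<not> adj u v" if "u \<in> J" for u
        using that adj_sym unfolding indep_def nbrs_def by blast+
      then show ?thesis using J assms(2) adj_irrefl unfolding indep_def by auto
    qed (auto simp: indep_def)
  qed
  have v: "v \<notin> I" "finite I" if "I \<in> indep ?W" for I
    using that assms(1) finite_subset unfolding indep_def by blast+
  have "inj_on (insert v) (indep ?W)"
    using v by (auto intro!: inj_onI simp: insert_ident)
  then have "(\<Sum>I\<in>insert v ` indep ?W. x ^ card I) = (\<Sum>I\<in>indep ?W. x ^ card (insert v I))"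
    by (simp add: sum.reindex)
  also have "\<dots> = x * ipoly x ?W"
    unfolding ipoly_def sum_distrib_left using v by (intro sum.cong) auto
  finally have "(\<Sum>I\<in>insert v ` indep ?W. x ^ card I) = x * ipoly x ?W" .
  moreover have "indep (V - {v}) \<inter> insert v ` indep ?W = {}"
    unfolding indep_def by blast
  ultimately show ?thesis
    unfolding ipoly_def[of x V] split
    using assms(1) by (subst sum.union_disjoint) (auto simp: finite_indep ipoly_def)
qed

text \<open>
  Delete the vertices of \<open>K\<close> one at a time: each deletion contributes \<open>x * ipoly x W\<close>, since the
  deleted vertex is adjacent to all that is left of \<open>K\<close> and to nothing in \<open>W\<close>.
\<close>

lemma ipoly_Un_clique:
  assumes "finite W" "finite K" "K \<inter> W = {}"
    and "\<And>u v. u \<in> K \<Longrightarrow> v \<in> K \<Longrightarrow> u \<noteq> v \<Longrightarrow> adj u v"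
    and "\<And>u v. u \<in> K \<Longrightarrow> v \<in> W \<Longrightarrow> \<not> adj u v"
  shows "ipoly x (K \<union> W) = (real (card K) * x + 1) * ipoly x W"
  using assms(2-)
proof (induction K rule: finite_induct)
  case empty
  then show ?case by simp
next
  case (insert u K)
  have 1: "insert u K \<union> W - {u} = K \<union> W"
    using insert.hyps insert.prems(1) by auto
  have 2: "K \<union> W - nbrs (insert u K \<union> W) u = W"
    using insert.prems insert.hyps unfolding nbrs_def by blast
  have "ipoly x (insert u K \<union> W) = ipoly x (K \<union> W) + x * ipoly x W"
    using ipoly_delete[of "insert u K \<union> W" u x] insert.hyps assms(1) unfolding 1 2 by simp
  also have "ipoly x (K \<union> W) = (real (card K) * x + 1) * ipoly x W"
    using insert.prems by (intro insert.IH) auto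
  finally show ?case using insert.hyps by (simp add: algebra_simps)
qed

lemma ipoly_clique:
  assumes "finite K" "\<And>u v. u \<in> K \<Longrightarrow> v \<in> K \<Longrightarrow> u \<noteq> v \<Longrightarrow> adj u v"
  shows "ipoly x K = real (card K) * x + 1"
  using ipoly_Un_clique[of "{}" K x] assms by (simp add: ipoly_empty)

section \<open>The lower bound and its equality case\<close>

text \<open>
  Deletion of a vertex of maximum degree, as sketched at the beginning. The equality case is part of
  the induction because equality for \<open>V\<close> is inherited by \<open>W\<close>.
\<close>

lemma ipoly_lower_bound:
  assumes "finite V" "x > 0"
  shows "(\<Prod>u\<in>V. clique_root x (card (nbrs V u))) \<le> ipoly x V
    \<and> (ipoly x V = (\<Prod>u\<in>V. clique_root x (card (nbrs V u))) \<longrightarrow> cluster V)"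
  using assms(1)
proof (induction "card V" arbitrary: V rule: less_induct)
  case less
  note fin = less.prems
  note w_pos = clique_root_pos[OF assms(2)] and w_mono = clique_root_antimono[OF assms(2)]
    and w_strict = clique_root_strict_antimono[OF assms(2)]
  let ?w = "clique_root x" and ?d = "\<lambda>V u. card (nbrs V u)"
  show ?case
  proof (cases "V = {}")
    case True
    then show ?thesis by (simp add: ipoly_empty cluster_def)
  next
    case False
    then have "Max (?d V ` V) \<in> ?d V ` V" using fin by (intro Max_in) auto
    then obtain v where v: "v \<in> V" "?d V v = Max (?d V ` V)" by auto
    have max: "?d V u \<le> ?d V v" if "u \<in> V" for u
      using that fin v(2) by simp
    define N W where "N = nbrs V v" and "W = V - {v} - N"
    have NW: "V = insert v (N \<union> W)" "V - {v} = N \<union> W" "N \<inter> W = {}" "v \<notin> N" "v \<notin> W"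
      using v(1) adj_irrefl[of v] unfolding N_def W_def nbrs_def by auto
    have finNW: "finite N" "finite W" using fin unfolding N_def W_def by (auto simp: finite_nbrs)
    define e where "e u = ?d V u - 1" for u
    have vu: "v \<in> nbrs V u" if "u \<in> N" for u
      using that v(1) adj_sym unfolding N_def nbrs_def by auto
    have e: "Suc (e u) = ?d V u" if "u \<in> N" for u
    proof -
      have "?d V u > 0" using vu[OF that] finite_nbrs[OF fin, of u] by (auto simp: card_gt_0_iff)
      then show ?thesis unfolding e_def by simp
    qed
    have dN: "?d (V - {v}) u = e u" if "u \<in> N" for u
    proof -
      have "nbrs (V - {v}) u = nbrs V u - {v}" unfolding nbrs_def by auto
      then show ?thesis using vu[OF that] by (simp add: e_def)
    qed
    define Q where "Q = (\<Prod>u\<in>W. ?w (?d V u))"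
    have Q: "Q > 0" unfolding Q_def using w_pos by (intro prod_pos) auto
    have sub: "?d U u \<le> ?d V u" if "U \<subseteq> V" for U u
      using that fin by (intro card_mono finite_nbrs) (auto simp: nbrs_def)
    have NV: "N \<subseteq> V" "W \<subseteq> V" using NW by auto
    have nb: "?w (?d V v) * (\<Prod>u\<in>N. ?w (Suc (e u))) \<le> (\<Prod>u\<in>N. ?w (e u)) + x
      \<and> ((\<exists>u\<in>N. Suc (e u) < ?d V v) \<longrightarrow>
        ?w (?d V v) * (\<Prod>u\<in>N. ?w (Suc (e u))) < (\<Prod>u\<in>N. ?w (e u)) + x)"
      using max e NV by (intro neighbourhood_inequality[OF assms(2)]) (auto simp: finNW Suc_le_eq[symmetric] N_def[symmetric])
    have total: "(\<Prod>u\<in>V. ?w (?d V u)) = Q * (?w (?d V v) * (\<Prod>u\<in>N. ?w (Suc (e u))))"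
      by (subst NW(1)) (use finNW NW(3-) e in \<open>simp add: prod.union_disjoint Q_def mult_ac\<close>)
    have "Q * (\<Prod>u\<in>N. ?w (e u)) = (\<Prod>u\<in>N. ?w (?d (V - {v}) u)) * Q"
      using dN by simp
    also have "\<dots> \<le> (\<Prod>u\<in>N. ?w (?d (V - {v}) u)) * (\<Prod>u\<in>W. ?w (?d (V - {v}) u))"
      unfolding Q_def using w_pos
      by (intro mult_left_mono prod_mono prod_nonneg) (auto intro!: w_mono sub simp: less_imp_le)
    also have "\<dots> = (\<Prod>u\<in>V - {v}. ?w (?d (V - {v}) u))"
      unfolding NW(2) using finNW NW(3) by (simp add: prod.union_disjoint)
    also have "\<dots> \<le> ipoly x (V - {v})"
      using less.hyps[OF card_Diff1_less[OF fin v(1)]] fin by blast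
    finally have del: "Q * (\<Prod>u\<in>N. ?w (e u)) \<le> ipoly x (V - {v})" .
    have QW: "Q \<le> (\<Prod>u\<in>W. ?w (?d W u))"
      unfolding Q_def using w_pos NV by (intro prod_mono) (auto intro!: w_mono sub simp: less_imp_le)
    have "W \<subset> V" using v(1) NV NW by auto
    then have "card W < card V" using fin by (intro psubset_card_mono)
    then have IH: "(\<Prod>u\<in>W. ?w (?d W u)) \<le> ipoly x W"
      "ipoly x W = (\<Prod>u\<in>W. ?w (?d W u)) \<Longrightarrow> cluster W"
      using less.hyps[of W] finNW by auto
    have rec: "ipoly x V = ipoly x (V - {v}) + x * ipoly x W"
      using ipoly_delete[OF fin v(1)] unfolding N_def W_def .
    have b1: "Q * (?w (?d V v) * (\<Prod>u\<in>N. ?w (Suc (e u)))) \<le> Q * ((\<Prod>u\<in>N. ?w (e u)) + x)"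
      using nb Q by (intro mult_left_mono) auto
    have b2: "x * Q \<le> x * ipoly x W" using QW IH(1) assms(2) by simp
    have bound: "(\<Prod>u\<in>V. ?w (?d V u)) \<le> ipoly x V"
      unfolding total rec using b1 b2 del by (simp add: algebra_simps)
    moreover have "cluster V" if eq: "ipoly x V = (\<Prod>u\<in>V. ?w (?d V u))"
    proof -
      have b3: "Q * ((\<Prod>u\<in>N. ?w (e u)) + x) = Q * (\<Prod>u\<in>N. ?w (e u)) + x * Q"
        by (simp add: algebra_simps)
      note tight = eq[unfolded total rec]
      have "x * Q = x * ipoly x W"
        using tight b1 b2 del unfolding b3 by linarith
      moreover have eq1:
        "Q * (?w (?d V v) * (\<Prod>u\<in>N. ?w (Suc (e u)))) = Q * ((\<Prod>u\<in>N. ?w (e u)) + x)"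
        using tight b1 b2 del unfolding b3 by linarith
      ultimately have eqW: "ipoly x W = (\<Prod>u\<in>W. ?w (?d W u))" "Q = (\<Prod>u\<in>W. ?w (?d W u))"
        using assms(2) QW IH(1) by simp_all
      have "cluster W" using IH(2) eqW(1) .
      \<comment> \<open>A smaller degree in \<open>W\<close> would make the bound for \<open>W\<close> strictly larger than \<open>Q\<close>.\<close>
      have dW: "?d W u = ?d V u" if "u \<in> W" for u
      proof (rule ccontr)
        assume "?d W u \<noteq> ?d V u"
        then have "?w (?d V u) < ?w (?d W u)" using sub[OF NV(2), of u] by (intro w_strict) simp
        then have "Q < (\<Prod>u\<in>W. ?w (?d W u))"
          unfolding Q_def using that finNW w_pos NV
          by (intro prod_mono_strict) (auto intro!: w_mono sub simp: less_imp_le)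
        then show False using eqW(2) by simp
      qed
      have sepW: "nbrs W u = nbrs V u" if "u \<in> W" for u
        using dW[OF that] fin NV by (intro card_subset_eq finite_nbrs) (auto simp: nbrs_def)
      have sep: "\<not> adj u t" if "u \<in> N" "t \<in> W" for u t
        using sepW[OF that(2)] that NV NW(3) adj_sym unfolding nbrs_def by blast
      have dNv: "?d V u = ?d V v" if "u \<in> N" for u
      proof (rule ccontr)
        assume "?d V u \<noteq> ?d V v"
        then have "Suc (e u) < ?d V v" using e[OF that] max[of u] NV that by fastforce
        then show False using nb that eq1 Q by auto
      qed
      \<comment> \<open>A neighbour \<open>u\<close> of \<open>v\<close> has as many neighbours as \<open>v\<close>, and all of them lie in
        \<open>insert v N - {u}\<close>, which has exactly that many elements.\<close>
      have clique: "adj u t" if "u \<in> insert v N" "t \<in> insert v N" "u \<noteq> t" for u t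
      proof (cases "u \<in> N")
        case False
        then show ?thesis using that NV unfolding N_def nbrs_def by auto
      next
        case True
        have "nbrs V u = insert v N - {u}"
        proof (rule card_subset_eq)
          show "finite (insert v N - {u})" using finNW by simp
          show "nbrs V u \<subseteq> insert v N - {u}"
            using sep[OF True] adj_irrefl NW(1) unfolding nbrs_def by auto
          show "card (nbrs V u) = card (insert v N - {u})"
            using dNv[OF True] True finNW NW(4) by (simp add: N_def[symmetric])
        qed
        then have "t \<in> nbrs V u" using that by auto
        then show ?thesis unfolding nbrs_def by auto
      qed
      have sepv: "\<not> adj u t" if "u \<in> insert v N" "t \<in> W" for u t
        using that sep[of u t] unfolding N_def W_def nbrs_def by auto
      show ?thesis unfolding cluster_def
      proof (intro ballI impI)
        fix a b c assume abc: "a \<in> V" "b \<in> V" "c \<in> V" "adj a b" "adj b c" "a \<noteq> c"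
        show "adj a c"
        proof (cases "b \<in> W")
          case True
          then have "a \<in> W" "c \<in> W" using abc sepv adj_sym NW(1) by blast+
          then show ?thesis using True abc \<open>cluster W\<close> unfolding cluster_def by blast
        next
          case False
          then have "a \<in> insert v N" "c \<in> insert v N" using abc sepv adj_sym NW(1) by blast+
          then show ?thesis using abc by (intro clique)
        qed
      qed
    qed
    ultimately show ?thesis by blast
  qed
qed

text \<open>
  In a cluster graph the closed neighbourhood of any vertex is an isolated clique. A clique on
  \<open>m + 1\<close> vertices contributes the factor \<open>clique_root x m ^ (m + 1)\<close>, its own polynomial.
\<close>

lemma ipoly_cluster:
  assumes "finite V" "x > 0" "cluster V"
  shows "ipoly x V = (\<Prod>u\<in>V. clique_root x (card (nbrs V u)))"
  using assms(1,3)
proof (induction "card V" arbitrary: V rule: less_induct)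
  case less
  let ?w = "clique_root x" and ?d = "\<lambda>V u. card (nbrs V u)"
  show ?case
  proof (cases "V = {}")
    case True
    then show ?thesis by (simp add: ipoly_empty)
  next
    case False
    then obtain v where v: "v \<in> V" by blast
    define K W where "K = insert v (nbrs V v)" and "W = V - K"
    have KW: "V = K \<union> W" "K \<inter> W = {}" "finite K" "finite W"
      using v less.prems(1) unfolding K_def W_def nbrs_def by auto
    have trans: "adj a c" if "a \<in> V" "b \<in> V" "c \<in> V" "adj a b" "adj b c" "a \<noteq> c" for a b c
      using less.prems(2) that unfolding cluster_def by blast
    have clique: "adj a b" if "a \<in> K" "b \<in> K" "a \<noteq> b" for a b
      using that trans[of a v b] adj_sym v unfolding K_def nbrs_def by auto
    have sep: "\<not> adj a b" if "a \<in> K" "b \<in> W" for a b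
      using that trans[of v a b] v unfolding K_def W_def nbrs_def by auto
    have "nbrs V u = K - {u}" if "u \<in> K" for u
      using that clique sep adj_irrefl KW(1) unfolding nbrs_def by auto
    then have dK: "?d V u = card K - 1" if "u \<in> K" for u using that KW(3) by simp
    have dW: "nbrs V u = nbrs W u" if "u \<in> W" for u
      using that sep adj_sym KW(1) unfolding nbrs_def by blast
    have "card K > 0" using KW(3) unfolding K_def by (simp add: card_gt_0_iff)
    then obtain m where m: "card K = Suc m" using gr0_implies_Suc by blast
    have "W \<subset> V" using KW(1,2) unfolding K_def by auto
    then have "card W < card V" using less.prems(1) by (intro psubset_card_mono)
    moreover have "cluster W" using less.prems(2) KW(1) unfolding cluster_def by blast
    ultimately have IH: "ipoly x W = (\<Prod>u\<in>W. ?w (?d W u))" using less.hyps[of W] KW(4) by blast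
    have "(\<Prod>u\<in>V. ?w (?d V u)) = (\<Prod>u\<in>K. ?w (?d V u)) * (\<Prod>u\<in>W. ?w (?d V u))"
      by (subst KW(1), subst prod.union_disjoint) (use KW in auto)
    also have "(\<Prod>u\<in>K. ?w (?d V u)) = ?w m ^ Suc m" using dK m by simp
    also have "\<dots> = real (card K) * x + 1" unfolding clique_root_pow[OF assms(2)] m by simp
    also have "(\<Prod>u\<in>W. ?w (?d V u)) = ipoly x W" using dW IH by simp
    also have "(real (card K) * x + 1) * ipoly x W = ipoly x V"
      by (subst KW(1), rule ipoly_Un_clique[symmetric]) (use KW clique sep in auto)
    finally show ?thesis ..
  qed
qed

end

section \<open>Graphs as symmetric digraphs\<close>

lemma (in graph) adjacency_dominates: "adjacency (\<lambda>u v. u \<rightarrow>\<^bsub>G\<^esub> v)"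
proof
  show "v \<rightarrow>\<^bsub>G\<^esub> u" if "u \<rightarrow>\<^bsub>G\<^esub> v" for u v
    using that sym_arcs by (rule arcs_ends_symmetric[rotated])
  show "\<not> u \<rightarrow>\<^bsub>G\<^esub> u" for u
    using no_loops by (auto simp: arcs_ends_conv)
qed

lemma indep_poly_eq_ipoly:
  assumes "adjacency (\<lambda>u v. u \<rightarrow>\<^bsub>G\<^esub> v)"
  shows "indep_poly G x = adjacency.ipoly (\<lambda>u v. u \<rightarrow>\<^bsub>G\<^esub> v) x (verts G)"
  unfolding indep_poly_def independent_sets_def adjacency.ipoly_def[OF assms]
    adjacency.indep_def[OF assms] ..

lemma indep_poly_complete_digraph:
  assumes "complete_digraph m G"
  shows "indep_poly G x = real m * x + 1"
proof -
  interpret graph G using assms unfolding complete_digraph_def by blast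
  interpret adjacency "\<lambda>u v. u \<rightarrow>\<^bsub>G\<^esub> v" by (rule adjacency_dominates)
  have "ipoly x (verts G) = real (card (verts G)) * x + 1"
    using assms by (intro ipoly_clique) (auto simp: complete_digraph_def)
  then show ?thesis
    using assms unfolding indep_poly_eq_ipoly[OF adjacency_dominates] complete_digraph_def by simp
qed

text \<open>
  The out-degree counts arcs; without parallel arcs the heads of the arcs leaving \<open>v\<close> are distinct.
\<close>

lemma (in graph) out_degree_eq_card_nbrs:
  "out_degree G v = card {w \<in> verts G. v \<rightarrow>\<^bsub>G\<^esub> w}"
proof -
  have "{w \<in> verts G. v \<rightarrow>\<^bsub>G\<^esub> w} = head G ` out_arcs G v"
    by (auto simp: out_arcs_def arcs_ends_conv)
  moreover have "inj_on (head G) (out_arcs G v)"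
    by (rule inj_onI) (auto simp: out_arcs_def arc_to_ends_def intro: no_multi_arcs)
  ultimately show ?thesis by (simp add: out_degree_def card_image)
qed

text \<open>
  If being adjacent or equal is transitive, the closed neighbourhoods are the vertex sets of the
  cliques. In the other direction, two arcs that share a vertex lie in the same clique by
  disjointness.
\<close>

lemma (in graph) disjoint_union_of_cliques_iff:
  "disjoint_union_of_cliques G \<longleftrightarrow>
    (\<forall>u\<in>verts G. \<forall>v\<in>verts G. \<forall>w\<in>verts G.
       u \<rightarrow>\<^bsub>G\<^esub> v \<longrightarrow> v \<rightarrow>\<^bsub>G\<^esub> w \<longrightarrow> u \<noteq> w \<longrightarrow> u \<rightarrow>\<^bsub>G\<^esub> w)"
proof
  assume "disjoint_union_of_cliques G"
  then obtain \<C> where \<C>: "(\<forall>C\<in>\<C>. compatible G C \<and> (\<exists>m\<ge>1. complete_digraph m C)) \<and>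
      (\<forall>C\<in>\<C>. \<forall>D\<in>\<C>. C \<noteq> D \<longrightarrow> verts C \<inter> verts D = {}) \<and> G = Union \<C>"
    unfolding disjoint_union_of_cliques_def by (elim exE) (rule that)
  note C = conjunct1[OF \<C>] and disj = conjunct1[OF conjunct2[OF \<C>]]
    and G = conjunct2[OF conjunct2[OF \<C>]]
  have arcsG: "arcs G = (\<Union>C\<in>\<C>. arcs C)"
    by (rule trans[OF arg_cong[OF G, of arcs]]) (simp add: Union_def)
  have dom: "u \<rightarrow>\<^bsub>G\<^esub> v \<longleftrightarrow> (\<exists>C\<in>\<C>. u \<rightarrow>\<^bsub>C\<^esub> v)" for u v
  proof -
    have "arcs_ends C = (\<lambda>a. (tail G a, head G a)) ` arcs C" if "C \<in> \<C>" for C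
      using C that by (simp add: arcs_ends_conv compatible_def)
    then show ?thesis by (simp add: arcs_ends_conv[of G] arcsG image_UN)
  qed
  have compl: "u \<rightarrow>\<^bsub>C\<^esub> v \<longleftrightarrow> u \<in> verts C \<and> v \<in> verts C \<and> u \<noteq> v" if "C \<in> \<C>" for C u v
    using C that unfolding complete_digraph_def by auto
  have "u \<rightarrow>\<^bsub>G\<^esub> w" if "u \<rightarrow>\<^bsub>G\<^esub> v" "v \<rightarrow>\<^bsub>G\<^esub> w" "u \<noteq> w" for u v w
  proof -
    obtain C D where CD: "C \<in> \<C>" "u \<rightarrow>\<^bsub>C\<^esub> v" "D \<in> \<C>" "v \<rightarrow>\<^bsub>D\<^esub> w"
      using \<open>u \<rightarrow>\<^bsub>G\<^esub> v\<close> \<open>v \<rightarrow>\<^bsub>G\<^esub> w\<close> dom by blast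
    then have "v \<in> verts C \<inter> verts D" using compl by blast
    then have "C = D" using disj CD by blast
    then have "u \<rightarrow>\<^bsub>C\<^esub> w" using CD compl \<open>u \<noteq> w\<close> by blast
    then show ?thesis using CD(1) dom by blast
  qed
  then show "\<forall>u\<in>verts G. \<forall>v\<in>verts G. \<forall>w\<in>verts G.
       u \<rightarrow>\<^bsub>G\<^esub> v \<longrightarrow> v \<rightarrow>\<^bsub>G\<^esub> w \<longrightarrow> u \<noteq> w \<longrightarrow> u \<rightarrow>\<^bsub>G\<^esub> w" by blast
next
  assume trans: "\<forall>u\<in>verts G. \<forall>v\<in>verts G. \<forall>w\<in>verts G.
       u \<rightarrow>\<^bsub>G\<^esub> v \<longrightarrow> v \<rightarrow>\<^bsub>G\<^esub> w \<longrightarrow> u \<noteq> w \<longrightarrow> u \<rightarrow>\<^bsub>G\<^esub> w"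
  interpret adjacency "\<lambda>u v. u \<rightarrow>\<^bsub>G\<^esub> v" by (rule adjacency_dominates)
  define K where "K v = insert v {w \<in> verts G. v \<rightarrow>\<^bsub>G\<^esub> w}" for v
  define \<C> where "\<C> = (\<lambda>v. G \<restriction> K v) ` verts G"
  have tr: "u \<rightarrow>\<^bsub>G\<^esub> w" if "u \<rightarrow>\<^bsub>G\<^esub> v" "v \<rightarrow>\<^bsub>G\<^esub> w" "u \<noteq> w" for u v w
    using trans that adj_in_verts by blast
  have KV: "K v \<subseteq> verts G" if "v \<in> verts G" for v using that unfolding K_def by auto
  have clique: "a \<rightarrow>\<^bsub>G\<^esub> b" if "v \<in> verts G" "a \<in> K v" "b \<in> K v" "a \<noteq> b" for a b v
    using that tr[of a v b] adj_sym unfolding K_def by auto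
  have Keq: "K u = K v" if "u \<in> verts G" "v \<in> verts G" "z \<in> K u" "z \<in> K v" for u v z
  proof -
    have "u = v \<or> u \<rightarrow>\<^bsub>G\<^esub> v"
      using that tr[of u z v] adj_sym unfolding K_def by auto
    then have "w \<in> K u \<longleftrightarrow> w \<in> K v" for w
      using tr[of u v w] tr[of v u w] adj_sym[of u v] that(1,2) unfolding K_def by auto
    then show ?thesis by blast
  qed
  have "complete_digraph (card (K v)) (G \<restriction> K v)" if v: "v \<in> verts G" for v
    unfolding complete_digraph_def
  proof (intro conjI)
    have ind: "induced_subgraph (G \<restriction> K v) G" using KV[OF v] by (rule induced_induce)
    have "digraph (G \<restriction> K v)" "sym_digraph (G \<restriction> K v)"
      using ind by (rule digraphI_induced, rule induced_graph_imp_graph)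
    then show "graph (G \<restriction> K v)"
      by (simp add: graph_def pseudo_graph_def digraph_def)
    show "arcs_ends (G \<restriction> K v) = {(a, b). (a, b) \<in> verts (G \<restriction> K v) \<times> verts (G \<restriction> K v) \<and> a \<noteq> b}"
    proof (intro equalityI subsetI)
      fix z assume "z \<in> arcs_ends (G \<restriction> K v)"
      then show "z \<in> {(a, b). (a, b) \<in> verts (G \<restriction> K v) \<times> verts (G \<restriction> K v) \<and> a \<noteq> b}"
        using no_loops by (auto simp: arcs_ends_conv)
    next
      fix z assume "z \<in> {(a, b). (a, b) \<in> verts (G \<restriction> K v) \<times> verts (G \<restriction> K v) \<and> a \<noteq> b}"
      then obtain a b where z: "z = (a, b)" "a \<in> K v" "b \<in> K v" "a \<noteq> b" by auto
      then have "a \<rightarrow>\<^bsub>G\<^esub> b" using clique v by blast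
      then show "z \<in> arcs_ends (G \<restriction> K v)" using z by (auto simp: arcs_ends_conv)
    qed
  qed simp
  moreover have "card (K v) \<ge> 1" for v
    using finite_verts by (simp add: K_def Suc_le_eq card_gt_0_iff)
  moreover have "compatible G (G \<restriction> K v)" for v by (simp add: compatible_def)
  ultimately have "\<forall>C\<in>\<C>. compatible G C \<and> (\<exists>m\<ge>1. complete_digraph m C)"
    unfolding \<C>_def by blast
  moreover have "\<forall>C\<in>\<C>. \<forall>D\<in>\<C>. C \<noteq> D \<longrightarrow> verts C \<inter> verts D = {}"
    unfolding \<C>_def
  proof (intro ballI impI)
    fix C D assume "C \<in> (\<lambda>v. G \<restriction> K v) ` verts G" "D \<in> (\<lambda>v. G \<restriction> K v) ` verts G" and "C \<noteq> D"
    then obtain u v where uv: "u \<in> verts G" "v \<in> verts G" "C = G \<restriction> K u" "D = G \<restriction> K v" by blast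
    with \<open>C \<noteq> D\<close> have "K u \<noteq> K v" by auto
    then show "verts C \<inter> verts D = {}" using Keq uv by auto
  qed
  moreover have "G = Union \<C>"
  proof -
    have "verts G = (\<Union>C\<in>\<C>. verts C)" using KV by (auto simp: \<C>_def K_def)
    moreover have "arcs G = (\<Union>C\<in>\<C>. arcs C)"
    proof -
      have "\<exists>v\<in>verts G. a \<in> arcs (G \<restriction> K v)" if "a \<in> arcs G" for a
        using that by (intro bexI[of _ "tail G a"]) (auto simp: K_def arcs_ends_conv)
      then have "arcs G \<subseteq> (\<Union>C\<in>\<C>. arcs C)" unfolding \<C>_def by blast
      then show ?thesis unfolding \<C>_def by auto
    qed
    ultimately show ?thesis unfolding Union_def by simp
  qed
  ultimately show "disjoint_union_of_cliques G" unfolding disjoint_union_of_cliques_def by blast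
qed

theorem theorem1p7:
  fixes G :: "('a, 'b) pre_digraph" and x :: real
  assumes "graph G" and "x > 0"
  shows
    "indep_poly G x \<ge>
       (\<Prod>v\<in>verts G. indep_poly (complete_graph (out_degree G v + 1)) x
                        powr (1 / (real (out_degree G v) + 1))) \<and>
     (\<Prod>v\<in>verts G. indep_poly (complete_graph (out_degree G v + 1)) x
                        powr (1 / (real (out_degree G v) + 1))) =
       (\<Prod>v\<in>verts G. ((real (out_degree G v) + 1) * x + 1)
                        powr (1 / (real (out_degree G v) + 1))) \<and>
     (indep_poly G x =
        (\<Prod>v\<in>verts G. indep_poly (complete_graph (out_degree G v + 1)) x
                         powr (1 / (real (out_degree G v) + 1)))
      \<longleftrightarrow> disjoint_union_of_cliques G)"
proof -
  interpret graph G by (rule assms(1))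
  interpret adjacency "\<lambda>u v. u \<rightarrow>\<^bsub>G\<^esub> v" by (rule adjacency_dominates)
  have poly: "indep_poly (complete_graph (d + 1)) x = (real d + 1) * x + 1" for d
    using indep_poly_complete_digraph[OF complete_digraph_complete_graph[of "d + 1"]]
    by (simp add: add.commute)
  have deg: "out_degree G v = card (nbrs (verts G) v)" for v
    unfolding out_degree_eq_card_nbrs nbrs_def ..
  have P: "indep_poly G x = ipoly x (verts G)"
    by (rule indep_poly_eq_ipoly[OF adjacency_dominates])
  have cl: "disjoint_union_of_cliques G \<longleftrightarrow> cluster (verts G)"
    unfolding disjoint_union_of_cliques_iff cluster_def ..
  show ?thesis
    unfolding poly deg P cl
    using ipoly_lower_bound[OF finite_verts assms(2)] ipoly_cluster[OF finite_verts assms(2)]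
    unfolding clique_root_def by blast
qed

end
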